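(* Let $Y$ be a response variable, let $\mathcal{S}$ be a finite set of random variables not containing $Y$, and let $X\in\mathcal{S}$. Let $\mathfrak{S}$ be the set of probability distributions on $\mathcal{S}\cup\{Y\}$, equipped with the total variation distance. Let $\mathfrak{p}\in\mathfrak{S}$ be a distribution under which $Y$ has multiple Markov boundaries in $\mathcal{S}$, and such that $X$ belongs to at least one, but not all, of these Markov boundaries. Then for every neighborhood $\mathfrak{N}$ of $\mathfrak{p}$ in $\mathfrak{S}$, every identifiable measure $f:\mathfrak{S}\to\mathbb{R}$ of the strength of $X\to Y$ violates, on $\mathfrak{N}$, at least one of the criteria C1, C2, C3 below (for any choice of the positive quantity $c$ in C3): C1. $f$ is continuous under the total variation distance. C2. If under $\mathfrak{q}$ there is a unique Markov boundary $\mathcal{M}$ of $Y$ within $\mathcal{S}$, and $X\notin\mathcal{M}$, then $f(\mathfrak{q})=0$. C3. If under $\mathfrak{q}$ there is a unique Markov boundary $\mathcal{M}$ of $Y$ within $\mathcal{S}$, and $X\in\mathcal{M}$, then $|f(\mathfrak{q})|\ge c(X,Y,\mathcal{M}\setminus\{X\})$, where $c(X,Y,\mathcal{M}\setminus\{X\})>0$ is a positive constant depending only on $X$, $Y$, $\mathcal{M}\setminus\{X\}$ (that is, on these variables and their joint distribution under $\mathfrak{q}$). Equivalently, there is no $f:\mathfrak{S}\to\mathbb{R}$ that is continuous on $\mathfrak{N}$ and satisfies C2 and C3 for all $\mathfrak{q}\in\mathfrak{N}$.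
   Context: Sets of random variables are identified with the corresponding random vectors; $\perp$ denotes (conditional) statistical independence, and independence from the empty set holds trivially. The sample space of each variable is fixed, and $\mathfrak{S}$ consists of the joint distributions of $\mathcal{S}\cup\{Y\}$ on the product of these sample spaces. For a set $\mathcal{T}$ of variables not containing $W$, a subset $\mathcal{M}\subseteq\mathcal{T}$ is a Markov blanket of $W$ within $\mathcal{T}$ if $W\perp(\mathcal{T}\setminus\mathcal{M})\mid\mathcal{M}$. A Markov boundary is a Markov blanket none of whose proper subsets is a Markov blanket. An identifiable measure of the strength of $X\to Y$ is a functional $f:\mathfrak{S}\to\mathbb{R}$ of the joint distribution of $Y$ and $\mathcal{S}$. An example of an admissible $c$ in C3 is the conditional mutual information of $X$ and $Y$ given $\mathcal{M}\setminus\{X\}$. *)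

theory Defs
  imports "HOL-Probability.Probability"
begin

text \<open>
  The random variables are indexed by a type \<open>'i\<close>; \<open>E i\<close> is the (measurable) sample space of
  the variable \<open>i\<close>. Only \<open>space (E i)\<close> and \<open>sets (E i)\<close> matter, the measure carried by \<open>E i\<close>
  is never used. A joint distribution of the variables in \<open>V\<close> is a probability measure on the
  product \<open>PiM V E\<close>, so the variables themselves are the coordinate projections, and the random
  vector formed by \<open>A \<subseteq> V\<close> is \<open>\<lambda>\<omega>. restrict \<omega> A\<close>.
\<close>

definition joint_distributions :: "('i \<Rightarrow> 'a measure) \<Rightarrow> 'i set \<Rightarrow> ('i \<Rightarrow> 'a) measure set" where
  "joint_distributions E V = {q. prob_space q \<and> sets q = sets (PiM V E)}"

definition marginal :: "('i \<Rightarrow> 'a measure) \<Rightarrow> 'i set \<Rightarrow> ('i \<Rightarrow> 'a) measure \<Rightarrow> ('i \<Rightarrow> 'a) measure" where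
  "marginal E J q = distr q (PiM J E) (\<lambda>\<omega>. restrict \<omega> J)"


subsection \<open>Total variation distance\<close>

text \<open>
  The case distinction is needed only because \<^locale>\<open>Metric_space\<close> demands nonnegativity
  of the distance also for arguments outside the carrier.
\<close>

definition tv_dist ::
  "('i \<Rightarrow> 'a measure) \<Rightarrow> 'i set \<Rightarrow> ('i \<Rightarrow> 'a) measure \<Rightarrow> ('i \<Rightarrow> 'a) measure \<Rightarrow> real" where
  "tv_dist E V p q =
     (if p \<in> joint_distributions E V \<and> q \<in> joint_distributions E V
      then SUP A\<in>sets (PiM V E). \<bar>measure p A - measure q A\<bar> else 0)"

definition tv_topology :: "('i \<Rightarrow> 'a measure) \<Rightarrow> 'i set \<Rightarrow> ('i \<Rightarrow> 'a) measure topology" where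
  "tv_topology E V = Metric_space.mtopology (joint_distributions E V) (tv_dist E V)"

lemma tv_bdd_above:
  assumes "p \<in> joint_distributions E V" "q \<in> joint_distributions E V"
  shows "bdd_above ((\<lambda>A. \<bar>measure p A - measure q A\<bar>) ` sets (PiM V E))"
proof (rule bdd_aboveI2)
  fix A
  have "measure p A \<le> 1" "measure q A \<le> 1"
    using assms by (auto simp: joint_distributions_def prob_space.prob_le_1)
  moreover have "0 \<le> measure p A" "0 \<le> measure q A" by auto
  ultimately show "\<bar>measure p A - measure q A\<bar> \<le> 1" by linarith
qed

lemma tv_dist_upper:
  assumes "p \<in> joint_distributions E V" "q \<in> joint_distributions E V" "A \<in> sets (PiM V E)"
  shows "\<bar>measure p A - measure q A\<bar> \<le> tv_dist E V p q"
  using assms by (auto simp: tv_dist_def intro!: cSUP_upper tv_bdd_above)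

lemma tv_dist_least:
  assumes "p \<in> joint_distributions E V" "q \<in> joint_distributions E V"
    and "\<And>A. A \<in> sets (PiM V E) \<Longrightarrow> \<bar>measure p A - measure q A\<bar> \<le> c"
  shows "tv_dist E V p q \<le> c"
proof -
  have "sets (PiM V E) \<noteq> {}" using sets.top by blast
  then show ?thesis using assms by (auto simp: tv_dist_def intro: cSUP_least)
qed

lemma tv_dist_nonneg: "0 \<le> tv_dist E V p q"
proof (cases "p \<in> joint_distributions E V \<and> q \<in> joint_distributions E V")
  case True
  then have "\<bar>measure p {} - measure q {}\<bar> \<le> tv_dist E V p q"
    by (intro tv_dist_upper) auto
  then show ?thesis by simp
qed (simp only: tv_dist_def if_False order_refl)

lemma Metric_space_tv_dist: "Metric_space (joint_distributions E V) (tv_dist E V)"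
proof
  fix p q r :: "('a \<Rightarrow> 'b) measure"
  show "0 \<le> tv_dist E V p q" by (rule tv_dist_nonneg)
  show "tv_dist E V p q = tv_dist E V q p"
    by (simp add: tv_dist_def abs_minus_commute conj_commute)
  assume p: "p \<in> joint_distributions E V" and q: "q \<in> joint_distributions E V"
  show "tv_dist E V p q = 0 \<longleftrightarrow> p = q"
  proof
    assume 0: "tv_dist E V p q = 0"
    have fin: "finite_measure p" "finite_measure q" and sets: "sets p = sets (PiM V E)" "sets q = sets p"
      using p q by (auto simp: joint_distributions_def prob_space_def)
    show "p = q"
    proof (rule measure_eqI)
      show "sets p = sets q" using sets by simp
      fix A assume "A \<in> sets p"
      then have "measure p A = measure q A"
        using tv_dist_upper[OF p q, of A] 0 sets by simp
      then show "emeasure p A = emeasure q A"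
        using fin by (simp add: finite_measure.emeasure_eq_measure)
    qed
  next
    assume "p = q"
    then have "tv_dist E V p q \<le> 0" using p by (intro tv_dist_least) auto
    then show "tv_dist E V p q = 0" using tv_dist_nonneg[of E V p q] by linarith
  qed
  assume r: "r \<in> joint_distributions E V"
  show "tv_dist E V p r \<le> tv_dist E V p q + tv_dist E V q r"
  proof (rule tv_dist_least[OF p r])
    fix A assume "A \<in> sets (PiM V E)"
    then show "\<bar>measure p A - measure r A\<bar> \<le> tv_dist E V p q + tv_dist E V q r"
      using tv_dist_upper[OF p q, of A] tv_dist_upper[OF q r, of A] by linarith
  qed
qed


subsection \<open>Conditional independence and Markov boundaries\<close>

definition coord_algebra ::
  "('i \<Rightarrow> 'a measure) \<Rightarrow> ('i \<Rightarrow> 'a) measure \<Rightarrow> 'i set \<Rightarrow> ('i \<Rightarrow> 'a) measure" where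
  "coord_algebra E q C = vimage_algebra (space q) (\<lambda>\<omega>. restrict \<omega> C) (PiM C E)"

lemma subalgebra_coord_algebra:
  assumes "q \<in> joint_distributions E V" "C \<subseteq> V"
  shows "subalgebra q (coord_algebra E q C)"
proof -
  have sets: "sets q = sets (PiM V E)" using assms by (simp add: joint_distributions_def)
  have "(\<lambda>\<omega>. restrict \<omega> C) \<in> measurable q (PiM C E)"
    using measurable_restrict_subset[OF assms(2), of E]
    by (simp add: measurable_cong_sets[OF sets refl])
  then show ?thesis
    unfolding subalgebra_def coord_algebra_def
    using sets_image_in_sets[OF refl] by simp
qed

text \<open>
  Conditional independence of the random vectors \<open>A\<close> and \<open>B\<close> given the random vector \<open>C\<close> under
  \<open>q\<close>: \<open>P(A \<in> U, B \<in> W | C) = P(A \<in> U | C) P(B \<in> W | C)\<close> almost surely.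
\<close>

definition cond_indep ::
  "('i \<Rightarrow> 'a measure) \<Rightarrow> ('i \<Rightarrow> 'a) measure \<Rightarrow> 'i set \<Rightarrow> 'i set \<Rightarrow> 'i set \<Rightarrow> bool" where
  "cond_indep E q A B C \<longleftrightarrow>
     (\<forall>U\<in>sets (PiM A E). \<forall>W\<in>sets (PiM B E).
        AE \<omega> in q.
          real_cond_exp q (coord_algebra E q C)
            (\<lambda>x. indicator U (restrict x A) * indicator W (restrict x B)) \<omega>
          = real_cond_exp q (coord_algebra E q C) (\<lambda>x. indicator U (restrict x A)) \<omega>
            * real_cond_exp q (coord_algebra E q C) (\<lambda>x. indicator W (restrict x B)) \<omega>)"

definition markov_blanket ::
  "('i \<Rightarrow> 'a measure) \<Rightarrow> ('i \<Rightarrow> 'a) measure \<Rightarrow> 'i \<Rightarrow> 'i set \<Rightarrow> 'i set \<Rightarrow> bool" where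
  "markov_blanket E q W T M \<longleftrightarrow> M \<subseteq> T \<and> cond_indep E q {W} (T - M) M"

definition markov_boundary ::
  "('i \<Rightarrow> 'a measure) \<Rightarrow> ('i \<Rightarrow> 'a) measure \<Rightarrow> 'i \<Rightarrow> 'i set \<Rightarrow> 'i set \<Rightarrow> bool" where
  "markov_boundary E q W T M \<longleftrightarrow>
     markov_blanket E q W T M \<and> (\<forall>M'. M' \<subset> M \<longrightarrow> \<not> markov_blanket E q W T M')"

definition unique_markov_boundary ::
  "('i \<Rightarrow> 'a measure) \<Rightarrow> ('i \<Rightarrow> 'a) measure \<Rightarrow> 'i \<Rightarrow> 'i set \<Rightarrow> 'i set \<Rightarrow> bool" where
  "unique_markov_boundary E q W T M \<longleftrightarrow>
     markov_boundary E q W T M \<and> (\<forall>M'. markov_boundary E q W T M' \<longrightarrow> M' = M)"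


subsection \<open>The criteria on a set of distributions\<close>

text \<open>
  Continuity is that of the restriction of \<open>f\<close> to \<open>N\<close>, with the subspace topology.
\<close>

definition criterion_C1 ::
  "('i \<Rightarrow> 'a measure) \<Rightarrow> 'i \<Rightarrow> 'i set \<Rightarrow> ('i \<Rightarrow> 'a) measure set \<Rightarrow> (('i \<Rightarrow> 'a) measure \<Rightarrow> real) \<Rightarrow> bool"
where
  "criterion_C1 E Y S N f \<longleftrightarrow>
     continuous_map (subtopology (tv_topology E (insert Y S)) N) euclideanreal f"

definition criterion_C2 ::
  "('i \<Rightarrow> 'a measure) \<Rightarrow> 'i \<Rightarrow> 'i \<Rightarrow> 'i set \<Rightarrow> ('i \<Rightarrow> 'a) measure set \<Rightarrow>
   (('i \<Rightarrow> 'a) measure \<Rightarrow> real) \<Rightarrow> bool"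
where
  "criterion_C2 E X Y S N f \<longleftrightarrow>
     (\<forall>q\<in>N. \<forall>M. unique_markov_boundary E q Y S M \<and> X \<notin> M \<longrightarrow> f q = 0)"

text \<open>
  The quantity \<open>c\<close> sees \<open>X\<close>, \<open>Y\<close>, \<open>M - {X}\<close> and the joint distribution of these variables.
  Its positivity is required exactly where the criterion refers to it; conditional mutual
  information, for instance, is not positive at arbitrary arguments.
\<close>

definition criterion_C3 ::
  "('i \<Rightarrow> 'a measure) \<Rightarrow> ('i \<Rightarrow> 'i \<Rightarrow> 'i set \<Rightarrow> ('i \<Rightarrow> 'a) measure \<Rightarrow> real) \<Rightarrow> 'i \<Rightarrow> 'i \<Rightarrow> 'i set \<Rightarrow>
   ('i \<Rightarrow> 'a) measure set \<Rightarrow> (('i \<Rightarrow> 'a) measure \<Rightarrow> real) \<Rightarrow> bool"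
where
  "criterion_C3 E c X Y S N f \<longleftrightarrow>
     (\<forall>q\<in>N. \<forall>M. unique_markov_boundary E q Y S M \<and> X \<in> M \<longrightarrow>
        0 < c X Y (M - {X}) (marginal E ({X, Y} \<union> (M - {X})) q) \<and>
        c X Y (M - {X}) (marginal E ({X, Y} \<union> (M - {X})) q) \<le> \<bar>f q\<bar>)"

end

theory Submission
  imports Defs
begin

text \<open>
  Let \<open>M\<close> be any Markov boundary of \<open>Y\<close> under \<open>p\<close> and let \<open>T\<close> overwrite the coordinates in
  \<open>S - M\<close> by those of a fixed point \<open>s\<close>. The mixture \<open>q\<close> of \<open>p\<close> (weight \<open>1 - e\<close>) and the image of
  \<open>p\<close> under \<open>T\<close> (weight \<open>e\<close>) is within \<open>e\<close> of \<open>p\<close>, has the same marginal on \<open>M\<close> and \<open>Y\<close>, and \<open>M\<close>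
  is still a Markov blanket. If \<open>M'\<close> is a Markov blanket under \<open>q\<close>, then \<open>P(Y | M)\<close> is, \<open>q\<close>-almost
  surely, a function of \<open>M'\<close>; composing with \<open>T\<close> freezes the coordinates in \<open>M' - M\<close>, so
  that \<open>p\<close>-almost surely it is a function of \<open>M' \<inter> M\<close>. Hence \<open>M' \<inter> M\<close> is a Markov blanket under
  \<open>p\<close>, and \<open>M \<subseteq> M'\<close> by minimality: \<open>M\<close> is the unique Markov boundary under \<open>q\<close>. Letting \<open>e\<close> tend
  to \<open>0\<close>, a boundary avoiding \<open>X\<close> gives \<open>f p = 0\<close> by C1 and C2, whereas a boundary containing \<open>X\<close>
  gives \<open>\<bar>f p\<bar> > 0\<close> by C1 and C3, the bound in C3 being the same for all \<open>e\<close>.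
\<close>

subsection \<open>Conditional independence through conditional expectations\<close>

lemma joint_distributionsD:
  assumes "q \<in> joint_distributions E V"
  shows "prob_space q" "sets q = sets (PiM V E)" "space q = space (PiM V E)"
  using assms by (auto simp: joint_distributions_def dest: sets_eq_imp_space_eq)

section \<open>Sigma-algebras generated by sets of coordinates\<close>

lemma space_coord_algebra [simp]: "space (coord_algebra E q C) = space q"
  by (simp add: coord_algebra_def)

lemma coord_algebra_cong: "space q = space r \<Longrightarrow> coord_algebra E q C = coord_algebra E r C"
  by (simp add: coord_algebra_def)

lemma restrict_in_space_PiM:
  assumes "q \<in> joint_distributions E V" "C \<subseteq> V" "\<omega> \<in> space q"
  shows "restrict \<omega> C \<in> space (PiM C E)"
  using assms by (auto simp: joint_distributionsD(3) space_PiM PiE_iff)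

lemma sets_coord_algebra:
  assumes "q \<in> joint_distributions E V" "C \<subseteq> V"
  shows "sets (coord_algebra E q C) = {(\<lambda>\<omega>. restrict \<omega> C) -` A \<inter> space q |A. A \<in> sets (PiM C E)}"
  unfolding coord_algebra_def
  by (rule sets_vimage_algebra2) (use restrict_in_space_PiM[OF assms] in auto)

lemma measurable_restrict_coord_algebra:
  assumes "q \<in> joint_distributions E V" "C \<subseteq> D" "D \<subseteq> V"
  shows "(\<lambda>\<omega>. restrict \<omega> C) \<in> measurable (coord_algebra E q D) (PiM C E)"
proof -
  have "(\<lambda>\<omega>. restrict \<omega> D) \<in> measurable (coord_algebra E q D) (PiM D E)"
    unfolding coord_algebra_def
    by (rule measurable_vimage_algebra1) (use restrict_in_space_PiM[OF assms(1,3)] in auto)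
  from measurable_compose[OF this measurable_restrict_subset[OF assms(2)]]
  show ?thesis using assms(2) by (simp add: Int_absorb1)
qed

lemma measurable_component_coord_algebra:
  assumes "q \<in> joint_distributions E V" "C \<subseteq> V" "i \<in> C"
  shows "(\<lambda>\<omega>. \<omega> i) \<in> measurable (coord_algebra E q C) (E i)"
proof -
  from measurable_compose[OF measurable_restrict_coord_algebra[OF assms(1) order_refl assms(2)]
      measurable_component_singleton[OF assms(3)]]
  show ?thesis using assms(3) by simp
qed

lemma subalgebra_coord_algebra_mono:
  assumes "q \<in> joint_distributions E V" "C \<subseteq> D" "D \<subseteq> V"
  shows "subalgebra (coord_algebra E q D) (coord_algebra E q C)"
proof -
  have "(\<lambda>\<omega>. restrict \<omega> C) \<in> measurable (coord_algebra E q D) (PiM C E)"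
    by (rule measurable_restrict_coord_algebra[OF assms])
  then show ?thesis
    unfolding subalgebra_def coord_algebra_def[of E q C]
    using sets_image_in_sets[of "coord_algebra E q D" "space q"] by simp
qed

lemma measurable_indicator_restrict:
  assumes "q \<in> joint_distributions E V" "C \<subseteq> D" "D \<subseteq> V" "U \<in> sets (PiM C E)"
  shows "(\<lambda>\<omega>. indicator U (restrict \<omega> C) :: real) \<in> borel_measurable (coord_algebra E q D)"
  by (rule measurable_compose[OF measurable_restrict_coord_algebra[OF assms(1-3)]])
     (use assms(4) in simp)

lemma borel_measurable_coord_algebra_joint:
  assumes "q \<in> joint_distributions E V" "C \<subseteq> V" "g \<in> borel_measurable (coord_algebra E q C)"
  shows "g \<in> borel_measurable q"
  using measurable_from_subalg[OF subalgebra_coord_algebra[OF assms(1,2)] assms(3)] .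

text \<open>The level set of \<open>g\<close> through \<open>\<omega>\<close> is the preimage of a
  set under restriction to \<open>C\<close>, so it cannot separate two points that agree on
  \<open>C\<close>. The equality is pointwise, which makes it usable under several measures at
  once.\<close>

lemma coord_algebra_function_eq:
  fixes g :: "_ \<Rightarrow> real"
  assumes "q \<in> joint_distributions E V" "C \<subseteq> V" "g \<in> borel_measurable (coord_algebra E q C)"
    and "\<omega> \<in> space q" "\<omega>' \<in> space q" "restrict \<omega> C = restrict \<omega>' C"
  shows "g \<omega> = g \<omega>'"
proof -
  have "g -` {g \<omega>} \<inter> space q \<in> sets (coord_algebra E q C)"
    using measurable_sets[OF assms(3), of "{g \<omega>}"] by simp
  then obtain A where A: "g -` {g \<omega>} \<inter> space q = (\<lambda>\<omega>. restrict \<omega> C) -` A \<inter> space q"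
    using sets_coord_algebra[OF assms(1,2)] by auto
  have "\<omega> \<in> (\<lambda>\<omega>. restrict \<omega> C) -` A \<inter> space q" using A assms(4) by blast
  then have "\<omega>' \<in> (\<lambda>\<omega>. restrict \<omega> C) -` A \<inter> space q" using assms(5,6) by simp
  then have "\<omega>' \<in> g -` {g \<omega>} \<inter> space q" using A by blast
  then show ?thesis by simp
qed

text \<open>The product sigma-algebra over \<open>B \<union> C\<close> is generated by its
  components, and each component is already measurable for the algebra of \<open>B\<close> or of
  \<open>C\<close>. The intersections \<open>b \<inter> c\<close> then serve as a generating
  pi-system on which conditional independence can be tested.\<close>

lemma sets_coord_algebra_Un:
  assumes q: "q \<in> joint_distributions E V" and "B \<subseteq> V" "C \<subseteq> V"
  shows "sets (coord_algebra E q (B \<union> C)) =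
    sigma_sets (space q) {b \<inter> c |b c. b \<in> sets (coord_algebra E q B) \<and> c \<in> sets (coord_algebra E q C)}"
    (is "_ = sigma_sets _ ?P")
proof
  have sub: "sets (coord_algebra E q D) \<subseteq> sets (coord_algebra E q (B \<union> C))"
    if "D \<subseteq> B \<union> C" for D
    using subalgebra_coord_algebra_mono[OF q that] assms unfolding subalgebra_def by auto
  have P: "?P \<subseteq> sets (coord_algebra E q (B \<union> C))"
    using sub[of B] sub[of C] by blast
  then show "sigma_sets (space q) ?P \<subseteq> sets (coord_algebra E q (B \<union> C))"
    using sets.sigma_sets_subset[OF P] by simp
  let ?S = "sigma (space q) ?P"
  have sp: "?P \<subseteq> Pow (space q)"
    using P sets.sets_into_space[of _ "coord_algebra E q (B \<union> C)"] by auto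
  have sS: "sets ?S = sigma_sets (space q) ?P" and spS: "space ?S = space q"
    using sp by auto
  \<comment> \<open>Taking the whole space as the other factor places both algebras inside
    \<open>?P\<close>.\<close>
  have inP: "b \<in> ?P" if "b \<in> sets (coord_algebra E q B) \<or> b \<in> sets (coord_algebra E q C)" for b
  proof -
    have "space q \<in> sets (coord_algebra E q B)" "space q \<in> sets (coord_algebra E q C)"
      using sets.top[of "coord_algebra E q B"] sets.top[of "coord_algebra E q C"] by auto
    moreover have "b \<subseteq> space q" using that sets.sets_into_space by fastforce
    ultimately show ?thesis using that by blast
  qed
  have comp: "(\<lambda>\<omega>. \<omega> i) \<in> measurable ?S (E i)" if i: "i \<in> B \<union> C" for i
  proof -
    obtain D where D: "D = B \<or> D = C" "i \<in> D" using i by blast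
    have m: "(\<lambda>\<omega>. \<omega> i) \<in> measurable (coord_algebra E q D) (E i)"
      using measurable_component_coord_algebra[OF q _ D(2)] D(1) assms by auto
    show ?thesis
    proof (rule measurableI)
      show "\<omega> i \<in> space (E i)" if "\<omega> \<in> space ?S" for \<omega>
        using measurable_space[OF m] that spS by simp
      show "(\<lambda>\<omega>. \<omega> i) -` A \<inter> space ?S \<in> sets ?S" if "A \<in> sets (E i)" for A
      proof -
        have "(\<lambda>\<omega>. \<omega> i) -` A \<inter> space q \<in> sets (coord_algebra E q D)"
          using measurable_sets[OF m that] by simp
        then have "(\<lambda>\<omega>. \<omega> i) -` A \<inter> space q \<in> ?P" using inP D(1) by blast
        then show ?thesis unfolding sS spS by (rule sigma_sets.Basic)
      qed
    qed
  qed
  have "(\<lambda>\<omega>. restrict \<omega> (B \<union> C)) \<in> measurable ?S (PiM (B \<union> C) E)"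
    by (rule measurable_restrict[OF comp])
  then have "sets (coord_algebra E q (B \<union> C)) \<subseteq> sets ?S"
    unfolding coord_algebra_def[of E q "B \<union> C"] using spS by (intro sets_image_in_sets)
  then show "sets (coord_algebra E q (B \<union> C)) \<subseteq> sigma_sets (space q) ?P"
    using sS by simp
qed

section \<open>Conditional independence as equality of two conditional expectations\<close>

lemma finite_measure_subalgebra_coord_algebra:
  assumes "q \<in> joint_distributions E V" "C \<subseteq> V"
  shows "finite_measure_subalgebra q (coord_algebra E q C)"
  using subalgebra_coord_algebra[OF assms] joint_distributionsD(1)[OF assms(1)]
  by (simp add: finite_measure_subalgebra_def finite_measure_subalgebra_axioms_def prob_space_def)

lemma integrable_indicator_restrict:
  assumes q: "q \<in> joint_distributions E V" and "C \<subseteq> V" "U \<in> sets (PiM C E)"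
  shows "integrable q (\<lambda>\<omega>. indicator U (restrict \<omega> C) :: real)"
proof -
  interpret prob_space q by (rule joint_distributionsD(1)[OF q])
  have "(\<lambda>\<omega>. indicator U (restrict \<omega> C) :: real) \<in> borel_measurable q"
    by (rule borel_measurable_coord_algebra_joint[OF q assms(2)
          measurable_indicator_restrict[OF q order_refl assms(2,3)]])
  then show ?thesis
    by (intro integrable_const_bound[where B=1]) (auto simp: indicator_def)
qed

lemma integrable_mult_indicator_restrict:
  assumes q: "q \<in> joint_distributions E V" and "C \<subseteq> V" "U \<in> sets (PiM C E)" "integrable q h"
  shows "integrable q (\<lambda>\<omega>. indicator U (restrict \<omega> C) * h \<omega> :: real)"
proof (rule Bochner_Integration.integrable_bound[OF assms(4)])
  have "(\<lambda>\<omega>. indicator U (restrict \<omega> C) :: real) \<in> borel_measurable q"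
    by (rule borel_measurable_coord_algebra_joint[OF q assms(2)
          measurable_indicator_restrict[OF q order_refl assms(2,3)]])
  then show "(\<lambda>\<omega>. indicator U (restrict \<omega> C) * h \<omega>) \<in> borel_measurable q"
    using assms(4) by measurable
qed (auto simp: indicator_def)

text \<open>Dynkin's pi-lambda argument for signed integrands: agreement of the set integrals passes
  to complements and to countable disjoint unions.\<close>

lemma (in finite_measure) set_integral_eq_sigma_sets:
  fixes f g :: "'a \<Rightarrow> real"
  assumes "Int_stable P" "P \<subseteq> sets M" "space M \<in> P" "integrable M f" "integrable M g"
    and eq: "\<And>A. A \<in> P \<Longrightarrow> (\<integral>x\<in>A. f x \<partial>M) = (\<integral>x\<in>A. g x \<partial>M)"
    and "A \<in> sigma_sets (space M) P"
  shows "(\<integral>x\<in>A. f x \<partial>M) = (\<integral>x\<in>A. g x \<partial>M)"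
proof -
  have sub: "P \<subseteq> Pow (space M)" using assms(2) sets.space_closed by blast
  have setsM: "B \<in> sets M" if "B \<in> sigma_sets (space M) P" for B
    using sets.sigma_sets_subset[OF assms(2)] that by blast
  have si: "set_integrable M B f" "set_integrable M B g" if "B \<in> sets M" for B
    using that assms(4,5) unfolding set_integrable_def by (simp_all add: integrable_mult_indicator del: real_scaleR_def)
  show ?thesis
    using assms(1) sub assms(7)
  proof (induction rule: sigma_sets_induct_disjoint)
    case (basic A)
    then show ?case by (rule eq)
  next
    case empty
    show ?case by (simp add: set_lebesgue_integral_def)
  next
    case (compl A)
    have A: "A \<in> sets M" using setsM compl by auto
    \<comment> \<open>The complement is handled by subtracting from the total integral; the totals
      of \<open>f\<close> and \<open>g\<close> agree because the whole space belongs to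
      \<open>P\<close>.\<close>
    have *: "(\<integral>x\<in>space M - A. h x \<partial>M) = (\<integral>x\<in>space M. h x \<partial>M) - (\<integral>x\<in>A. h x \<partial>M)"
      if "\<And>B. B \<in> sets M \<Longrightarrow> set_integrable M B h" for h :: "'a \<Rightarrow> real"
    proof -
      have "(\<integral>x\<in>A \<union> (space M - A). h x \<partial>M) = (\<integral>x\<in>A. h x \<partial>M) + (\<integral>x\<in>space M - A. h x \<partial>M)"
        by (rule set_integral_Un) (use A that in auto)
      moreover have "A \<union> (space M - A) = space M" using sets.sets_into_space[OF A] by auto
      ultimately show ?thesis by simp
    qed
    show ?case
      using *[OF si(1)] *[OF si(2)] compl.IH eq[OF assms(3)] by simp
  next
    case (union A)
    have A: "A i \<in> sets M" for i using setsM union by auto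
    have U: "(\<Union>i. A i) \<in> sets M" using A by auto
    have "(\<integral>x\<in>(\<Union>i. A i). h x \<partial>M) = (\<Sum>i. \<integral>x\<in>A i. h x \<partial>M)"
      if "\<And>B. B \<in> sets M \<Longrightarrow> set_integrable M B h" for h :: "'a \<Rightarrow> real"
      by (rule lebesgue_integral_countable_add)
         (use A union.hyps that[OF U] in \<open>auto simp: disjoint_family_on_def\<close>)
    then show ?case using si union.IH by simp
  qed
qed

text \<open>The asymmetric form of conditional independence: once \<open>C\<close> is known,
  learning \<open>B\<close> does not change the conditional law of \<open>A\<close>. From left to
  right, P(A | C) is tested on the generating rectangles; from right to left, one conditions on
  \<open>B \<union> C\<close> first and on \<open>C\<close> afterwards.\<close>

lemma cond_indep_iff:
  assumes q: "q \<in> joint_distributions E V" and A: "A \<subseteq> V" and B: "B \<subseteq> V" and C: "C \<subseteq> V"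
  shows "cond_indep E q A B C \<longleftrightarrow>
    (\<forall>U\<in>sets (PiM A E). AE \<omega> in q.
       real_cond_exp q (coord_algebra E q (B \<union> C)) (\<lambda>x. indicator U (restrict x A)) \<omega>
       = real_cond_exp q (coord_algebra E q C) (\<lambda>x. indicator U (restrict x A)) \<omega>)"
    (is "_ \<longleftrightarrow> (\<forall>U\<in>_. ?R U)")
proof -
  let ?C = "coord_algebra E q C" and ?BC = "coord_algebra E q (B \<union> C)"
  have BC: "B \<union> C \<subseteq> V" using B C by simp
  interpret prob_space q by (rule joint_distributionsD(1)[OF q])
  interpret FC: finite_measure_subalgebra q ?C by (rule finite_measure_subalgebra_coord_algebra[OF q C])
  interpret FBC: finite_measure_subalgebra q ?BC by (rule finite_measure_subalgebra_coord_algebra[OF q BC])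
  have sub: "subalgebra ?BC ?C" by (rule subalgebra_coord_algebra_mono[OF q _ BC]) simp
  show ?thesis
  proof (intro iffI ballI)
    fix U assume ci: "cond_indep E q A B C" and U: "U \<in> sets (PiM A E)"
    let ?u = "\<lambda>x. indicator U (restrict x A) :: real"
    have iu: "integrable q ?u" by (rule integrable_indicator_restrict[OF q A U])
    have ig: "integrable q (real_cond_exp q ?C ?u)" using FC.real_cond_exp_int(1)[OF iu] .
    let ?P = "{b \<inter> c |b c. b \<in> sets (coord_algebra E q B) \<and> c \<in> sets ?C}"
    \<comment> \<open>On a rectangle the \<open>B\<close>-factor becomes the weight
      \<open>?w\<close>, leaving an integral over the \<open>C\<close>-event \<open>c\<close>, where
      conditioning on \<open>C\<close> is allowed.\<close>
    have base: "(\<integral>x\<in>D. ?u x \<partial>q) = (\<integral>x\<in>D. real_cond_exp q ?C ?u x \<partial>q)" if D_P: "D \<in> ?P" for D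
    proof -
      obtain W c where W: "W \<in> sets (PiM B E)" and c: "c \<in> sets ?C"
        and D: "D = ((\<lambda>\<omega>. restrict \<omega> B) -` W \<inter> space q) \<inter> c"
      proof -
        obtain b c where b: "b \<in> sets (coord_algebra E q B)" and c: "c \<in> sets ?C" and D: "D = b \<inter> c"
          using D_P by blast
        obtain W where W: "W \<in> sets (PiM B E)" "b = (\<lambda>\<omega>. restrict \<omega> B) -` W \<inter> space q"
          using b unfolding sets_coord_algebra[OF q B] by blast
        show thesis by (rule that) (use W c D in simp_all)
      qed
      let ?w = "\<lambda>x. indicator W (restrict x B) :: real"
      have iw: "integrable q ?w" by (rule integrable_indicator_restrict[OF q B W])
      have iuw: "integrable q (\<lambda>x. ?u x * ?w x)"
        by (rule integrable_mult_indicator_restrict[OF q A U iw])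
      have igw: "integrable q (\<lambda>x. real_cond_exp q ?C ?u x * ?w x)"
        using integrable_mult_indicator_restrict[OF q B W ig] by (simp add: mult.commute)
      have ind: "indicator D x = ?w x * indicator c x" if "x \<in> space q" for x
        using that by (auto simp: D indicator_def)
      have "(\<integral>x\<in>D. ?u x \<partial>q) = (\<integral>x\<in>c. ?u x * ?w x \<partial>q)"
        unfolding set_lebesgue_integral_def
        by (rule Bochner_Integration.integral_cong) (auto simp: ind)
      also have "\<dots> = (\<integral>x\<in>c. real_cond_exp q ?C (\<lambda>x. ?u x * ?w x) x \<partial>q)"
        by (rule FC.real_cond_exp_intA[OF iuw c])
      \<comment> \<open>Both integrands equal the product of the conditional expectations of
        \<open>?u\<close> and \<open>?w\<close>: the first by conditional independence, the second
        by pulling out a factor measurable for \<open>?C\<close>.\<close>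
      also have "\<dots> = (\<integral>x\<in>c. real_cond_exp q ?C (\<lambda>x. real_cond_exp q ?C ?u x * ?w x) x \<partial>q)"
      proof -
        have "AE x in q. real_cond_exp q ?C (\<lambda>x. ?u x * ?w x) x
            = real_cond_exp q ?C ?u x * real_cond_exp q ?C ?w x"
          using ci U W unfolding cond_indep_def by blast
        moreover have "AE x in q. real_cond_exp q ?C (\<lambda>x. real_cond_exp q ?C ?u x * ?w x) x
            = real_cond_exp q ?C ?u x * real_cond_exp q ?C ?w x"
          by (rule FC.real_cond_exp_mult[OF _ _ igw]) (use iw in auto)
        ultimately have "AE x in q. real_cond_exp q ?C (\<lambda>x. ?u x * ?w x) x
            = real_cond_exp q ?C (\<lambda>x. real_cond_exp q ?C ?u x * ?w x) x"
          by eventually_elim simp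
        moreover have "c \<in> sets q" using c FC.subalg unfolding subalgebra_def by blast
        ultimately show ?thesis
          unfolding set_lebesgue_integral_def
          by (intro integral_cong_AE) (auto elim: eventually_mono)
      qed
      also have "\<dots> = (\<integral>x\<in>c. real_cond_exp q ?C ?u x * ?w x \<partial>q)"
        by (rule FC.real_cond_exp_intA[OF igw c, symmetric])
      also have "\<dots> = (\<integral>x\<in>D. real_cond_exp q ?C ?u x \<partial>q)"
        unfolding set_lebesgue_integral_def
        by (rule Bochner_Integration.integral_cong) (auto simp: ind)
      finally show ?thesis .
    qed
    have P_sub: "?P \<subseteq> sets q"
      using subalgebra_coord_algebra[OF q B] subalgebra_coord_algebra[OF q C]
      unfolding subalgebra_def by blast
    have P_int: "Int_stable ?P"
    proof (rule Int_stableI)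
      fix a b assume "a \<in> ?P" "b \<in> ?P"
      then obtain a1 a2 b1 b2 where "a = a1 \<inter> a2" "b = b1 \<inter> b2"
        "a1 \<in> sets (coord_algebra E q B)" "b1 \<in> sets (coord_algebra E q B)"
        "a2 \<in> sets ?C" "b2 \<in> sets ?C" by blast
      moreover have "a1 \<inter> a2 \<inter> (b1 \<inter> b2) = (a1 \<inter> b1) \<inter> (a2 \<inter> b2)" by blast
      ultimately show "a \<inter> b \<in> ?P" by blast
    qed
    have P_top: "space q \<in> ?P"
      using sets.top[of ?C] sets.top[of "coord_algebra E q B"] Int_absorb[of "space q"]
      unfolding space_coord_algebra mem_Collect_eq by metis
    show "?R U"
    proof (rule FBC.real_cond_exp_charact[OF _ iu ig])
      show "real_cond_exp q ?C ?u \<in> borel_measurable ?BC"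
        by (rule measurable_from_subalg[OF sub]) simp
      fix D assume "D \<in> sets ?BC"
      then have "D \<in> sigma_sets (space q) ?P" using sets_coord_algebra_Un[OF q B C] by simp
      then show "(\<integral>x\<in>D. ?u x \<partial>q) = (\<integral>x\<in>D. real_cond_exp q ?C ?u x \<partial>q)"
        using set_integral_eq_sigma_sets[OF P_int P_sub P_top iu ig base] by blast
    qed
  next
    assume R: "\<forall>U\<in>sets (PiM A E). ?R U"
    show "cond_indep E q A B C"
      unfolding cond_indep_def
    proof (intro ballI)
      fix U W assume U: "U \<in> sets (PiM A E)" and W: "W \<in> sets (PiM B E)"
      let ?u = "\<lambda>x. indicator U (restrict x A) :: real"
      let ?w = "\<lambda>x. indicator W (restrict x B) :: real"
      have iu: "integrable q ?u" by (rule integrable_indicator_restrict[OF q A U])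
      have iw: "integrable q ?w" by (rule integrable_indicator_restrict[OF q B W])
      have iwu: "integrable q (\<lambda>x. ?w x * ?u x)"
        by (rule integrable_mult_indicator_restrict[OF q B W iu])
      have ig: "integrable q (real_cond_exp q ?C ?u)" using FC.real_cond_exp_int(1)[OF iu] .
      have igw: "integrable q (\<lambda>x. real_cond_exp q ?C ?u x * ?w x)"
        using integrable_mult_indicator_restrict[OF q B W ig] by (simp add: mult.commute)
      have wm: "?w \<in> borel_measurable ?BC"
        by (rule measurable_indicator_restrict[OF q _ BC W]) simp
      \<comment> \<open>Given \<open>B \<union> C\<close>, the factor \<open>?w\<close> is known and
        comes out; the hypothesis then replaces the remaining factor by its
        \<open>C\<close>-version, and the tower property brings everything down to
        \<open>?C\<close>.\<close>
      have 1: "AE x in q. real_cond_exp q ?BC (\<lambda>x. ?w x * ?u x) x = ?w x * real_cond_exp q ?BC ?u x"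
        by (rule FBC.real_cond_exp_mult[OF wm _ iwu]) (use iu in auto)
      have "AE x in q. real_cond_exp q ?BC ?u x = real_cond_exp q ?C ?u x"
        using R U by blast
      with 1 have 2: "AE x in q. real_cond_exp q ?BC (\<lambda>x. ?w x * ?u x) x = real_cond_exp q ?C ?u x * ?w x"
        by eventually_elim simp
      have 3: "AE x in q. real_cond_exp q ?C (real_cond_exp q ?BC (\<lambda>x. ?w x * ?u x)) x
          = real_cond_exp q ?C (\<lambda>x. ?w x * ?u x) x"
        by (rule FC.real_cond_exp_nested_subalg[OF FBC.subalg sub iwu])
      have 4: "AE x in q. real_cond_exp q ?C (real_cond_exp q ?BC (\<lambda>x. ?w x * ?u x)) x
          = real_cond_exp q ?C (\<lambda>x. real_cond_exp q ?C ?u x * ?w x) x"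
        by (rule FC.real_cond_exp_cong[OF 2]) (use igw in auto)
      have 5: "AE x in q. real_cond_exp q ?C (\<lambda>x. real_cond_exp q ?C ?u x * ?w x) x
            = real_cond_exp q ?C ?u x * real_cond_exp q ?C ?w x"
        by (rule FC.real_cond_exp_mult[OF _ _ igw]) (use iw in auto)
      have "(\<lambda>x. ?u x * ?w x) = (\<lambda>x. ?w x * ?u x)" by (simp add: mult.commute)
      moreover from 3 4 5 have "AE x in q. real_cond_exp q ?C (\<lambda>x. ?w x * ?u x) x
            = real_cond_exp q ?C ?u x * real_cond_exp q ?C ?w x"
        by eventually_elim simp
      ultimately show "AE x in q. real_cond_exp q ?C (\<lambda>x. ?u x * ?w x) x
            = real_cond_exp q ?C ?u x * real_cond_exp q ?C ?w x"
        by simp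
    qed
  qed
qed

text \<open>Since \<open>M\<close> and \<open>S - M\<close> together make up \<open>S\<close>, the
  blanket condition says that the conditional law of \<open>Y\<close> given all of \<open>S\<close>
  is already the one given \<open>M\<close>.\<close>

lemma markov_blanket_iff:
  assumes q: "q \<in> joint_distributions E (insert Y S)" and MS: "M \<subseteq> S"
  shows "markov_blanket E q Y S M \<longleftrightarrow>
    (\<forall>U\<in>sets (PiM {Y} E). AE \<omega> in q.
       real_cond_exp q (coord_algebra E q S) (\<lambda>x. indicator U (restrict x {Y})) \<omega>
       = real_cond_exp q (coord_algebra E q M) (\<lambda>x. indicator U (restrict x {Y})) \<omega>)"
proof -
  have "S - M \<union> M = S" using MS by blast
  with cond_indep_iff[OF q, of "{Y}" "S - M" M] MS show ?thesis
    unfolding markov_blanket_def by auto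
qed

text \<open>It suffices to exhibit any \<open>M\<close>-measurable version of P(Y | S): conditioning
  it on \<open>M\<close> leaves it fixed, while the tower property turns P(Y | S) into P(Y |
  M).\<close>

lemma markov_blanketI:
  assumes q: "q \<in> joint_distributions E (insert Y S)" and MS: "M \<subseteq> S"
    and g: "\<And>U. U \<in> sets (PiM {Y} E) \<Longrightarrow> \<exists>g\<in>borel_measurable (coord_algebra E q M). AE \<omega> in q.
       real_cond_exp q (coord_algebra E q S) (\<lambda>x. indicator U (restrict x {Y})) \<omega> = g \<omega>"
  shows "markov_blanket E q Y S M"
  unfolding markov_blanket_iff[OF q MS]
proof
  fix U assume U: "U \<in> sets (PiM {Y} E)"
  let ?u = "\<lambda>x. indicator U (restrict x {Y}) :: real"
  let ?S = "coord_algebra E q S" and ?M = "coord_algebra E q M"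
  have SV: "S \<subseteq> insert Y S" and MV: "M \<subseteq> insert Y S" using MS by auto
  interpret FM: finite_measure_subalgebra q ?M by (rule finite_measure_subalgebra_coord_algebra[OF q MV])
  interpret FS: finite_measure_subalgebra q ?S by (rule finite_measure_subalgebra_coord_algebra[OF q SV])
  from g[OF U] obtain g where gm: "g \<in> borel_measurable ?M"
    and g: "AE \<omega> in q. real_cond_exp q ?S ?u \<omega> = g \<omega>" by blast
  have gq: "g \<in> borel_measurable q" by (rule borel_measurable_coord_algebra_joint[OF q MV gm])
  have iu: "integrable q ?u" by (rule integrable_indicator_restrict[OF q _ U]) simp
  have ius: "integrable q (real_cond_exp q ?S ?u)" using FS.real_cond_exp_int(1)[OF iu] .
  \<comment> \<open>Integrability of \<open>g\<close> is inherited from the conditional expectation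
    with which it agrees almost surely.\<close>
  have ig: "integrable q g"
    using ius integrable_cong_AE[OF borel_measurable_cond_exp2 gq g] by simp
  have "AE x in q. real_cond_exp q ?M (real_cond_exp q ?S ?u) x = real_cond_exp q ?M ?u x"
    by (rule FM.real_cond_exp_nested_subalg[OF FS.subalg subalgebra_coord_algebra_mono[OF q MS SV] iu])
  moreover have "AE x in q. real_cond_exp q ?M (real_cond_exp q ?S ?u) x = real_cond_exp q ?M g x"
    by (rule FM.real_cond_exp_cong[OF g]) (use gq in auto)
  moreover have "AE x in q. real_cond_exp q ?M g x = g x"
    by (rule FM.real_cond_exp_F_meas[OF ig gm])
  ultimately show "AE \<omega> in q. real_cond_exp q ?S ?u \<omega> = real_cond_exp q ?M ?u \<omega>"
    using g by eventually_elim simp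
qed

subsection \<open>Mixtures of probability measures\<close>

text \<open>Encoded as a two-stage experiment: a coin with success probability \<open>e\<close>
  chooses \<open>r\<close> on \<open>True\<close> and \<open>p\<close> on \<open>False\<close>.
  Integrals and almost-sure statements then follow from the rules for \<open>bind\<close>.\<close>

definition mixture :: "real \<Rightarrow> 'a measure \<Rightarrow> 'a measure \<Rightarrow> 'a measure" where
  "mixture e p r = measure_pmf (bernoulli_pmf e) \<bind> (\<lambda>b. if b then r else p)"

context
  fixes p r :: "'a measure" and e :: real
  assumes p: "prob_space p" and r: "prob_space r" and sets_r: "sets r = sets p"
    and e: "0 \<le> e" "e \<le> 1"
begin

lemma kernel_mixture:
  "(\<lambda>b. if b then r else p) \<in> measurable (measure_pmf (bernoulli_pmf e)) (subprob_algebra p)"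
  using p r sets_r by (auto simp: space_subprob_algebra prob_space_imp_subprob_space)

lemma sets_mixture: "sets (mixture e p r) = sets p"
  unfolding mixture_def
  by (rule sets_bind) (auto simp: sets_r)

lemma nn_integral_mixture:
  assumes "f \<in> borel_measurable p"
  shows "(\<integral>\<^sup>+x. f x \<partial>mixture e p r) = e * (\<integral>\<^sup>+x. f x \<partial>r) + (1 - e) * (\<integral>\<^sup>+x. f x \<partial>p)"
  unfolding mixture_def
  by (subst nn_integral_bind[OF assms kernel_mixture]) (use e in \<open>simp add: mult.commute\<close>)

lemma emeasure_mixture:
  assumes "A \<in> sets p"
  shows "emeasure (mixture e p r) A = e * emeasure r A + (1 - e) * emeasure p A"
  using nn_integral_mixture[of "indicator A"] assms by (simp add: sets_mixture sets_r)

lemma prob_space_mixture: "prob_space (mixture e p r)"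
proof
  have "space (mixture e p r) = space p" "space r = space p"
    using sets_eq_imp_space_eq[OF sets_mixture] sets_eq_imp_space_eq[OF sets_r] by auto
  then show "emeasure (mixture e p r) (space (mixture e p r)) = 1"
    using emeasure_mixture[of "space p"] prob_space.emeasure_space_1[OF p]
      prob_space.emeasure_space_1[OF r] e
    by (simp flip: ennreal_plus)
qed

lemma measure_mixture:
  assumes "A \<in> sets p"
  shows "measure (mixture e p r) A = e * measure r A + (1 - e) * measure p A"
proof -
  interpret p: prob_space p by (rule p)
  interpret r: prob_space r by (rule r)
  interpret m: prob_space "mixture e p r" by (rule prob_space_mixture)
  have "ennreal (measure (mixture e p r) A) = ennreal (e * measure r A + (1 - e) * measure p A)"
    using emeasure_mixture[OF assms] e
    by (simp add: p.emeasure_eq_measure r.emeasure_eq_measure m.emeasure_eq_measure ennreal_mult'')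
  then show ?thesis
    by (subst (asm) ennreal_inj) (use e in auto)
qed

text \<open>The outcome \<open>True\<close> has mass \<open>e\<close>, so for \<open>0 < e\<close> a
  null set of the mixture must be null for \<open>r\<close>.\<close>

lemma AE_mixture:
  assumes "Measurable.pred p P" "0 < e" and "AE x in mixture e p r. P x"
  shows "AE x in r. P x"
proof -
  have "AE b in measure_pmf (bernoulli_pmf e). AE x in if b then r else p. P x"
    using assms(3) AE_bind[OF kernel_mixture assms(1)] unfolding mixture_def by blast
  then have "\<forall>b\<in>set_pmf (bernoulli_pmf e). AE x in if b then r else p. P x"
    by (simp only: AE_measure_pmf_iff)
  moreover have "True \<in> set_pmf (bernoulli_pmf e)"
    using assms(2) e by (simp add: set_pmf_iff)
  ultimately have "AE x in if True then r else p. P x" by (rule bspec)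
  then show ?thesis unfolding if_True .
qed

lemma
  fixes f :: "'a \<Rightarrow> real"
  assumes fp: "integrable p f" and fr: "integrable r f"
  shows integrable_mixture: "integrable (mixture e p r) f"
    and integral_mixture:
      "(\<integral>x. f x \<partial>mixture e p r) = e * (\<integral>x. f x \<partial>r) + (1 - e) * (\<integral>x. f x \<partial>p)"
proof -
  have fm [measurable]: "f \<in> borel_measurable p" using fp by simp
  have fin: "(\<integral>\<^sup>+x. ennreal (f x) \<partial>s) < \<infinity>" "(\<integral>\<^sup>+x. ennreal (- f x) \<partial>s) < \<infinity>"
    if "integrable s f" for s
    using that by (simp_all only: real_integrable_def infinity_ennreal_def less_top)
  have fin': "(\<integral>\<^sup>+x. ennreal (norm (f x)) \<partial>s) < \<infinity>" if "integrable s f" for s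
    using that by (simp only: integrable_iff_bounded)
  have "(\<integral>\<^sup>+x. ennreal (norm (f x)) \<partial>mixture e p r) < \<infinity>"
    using fin'[OF fp] fin'[OF fr]
    by (subst nn_integral_mixture) (auto simp: ennreal_mult_less_top)
  moreover have "f \<in> borel_measurable (mixture e p r)"
    using fm measurable_cong_sets[OF sets_mixture refl] by blast
  ultimately show int: "integrable (mixture e p r) f"
    by (simp add: integrable_iff_bounded)
  \<comment> \<open>Finiteness matters here: \<open>enn2real\<close> sends infinity to 0 and is
    additive only on finite values. The formula is then applied to the positive and negative parts
    of \<open>f\<close> separately.\<close>
  have *: "enn2real (e * a + (1 - e) * b) = e * enn2real a + (1 - e) * enn2real b"
    if "a < \<infinity>" "b < \<infinity>" for a b :: ennreal
    using that e by (subst enn2real_plus) (auto simp: enn2real_mult ennreal_mult_less_top)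
  have "(\<integral>x. f x \<partial>mixture e p r) = (e * enn2real (\<integral>\<^sup>+x. ennreal (f x) \<partial>r)
       + (1 - e) * enn2real (\<integral>\<^sup>+x. ennreal (f x) \<partial>p))
     - (e * enn2real (\<integral>\<^sup>+x. ennreal (- f x) \<partial>r) + (1 - e) * enn2real (\<integral>\<^sup>+x. ennreal (- f x) \<partial>p))"
    using fin(1,2)[OF fp] fin(1,2)[OF fr]
    by (simp add: real_lebesgue_integral_def[OF int] nn_integral_mixture *)
  also have "\<dots> = e * (\<integral>x. f x \<partial>r) + (1 - e) * (\<integral>x. f x \<partial>p)"
    unfolding real_lebesgue_integral_def[OF fp] real_lebesgue_integral_def[OF fr]
    by (simp add: algebra_simps)
  finally show "(\<integral>x. f x \<partial>mixture e p r) = e * (\<integral>x. f x \<partial>r) + (1 - e) * (\<integral>x. f x \<partial>p)" .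
qed

end

subsection \<open>Perturbing a joint distribution\<close>

lemma override_on_in_space:
  assumes "p \<in> joint_distributions E V" "K \<subseteq> V" "s \<in> space p" "\<omega> \<in> space p"
  shows "override_on \<omega> s K \<in> space p"
  using assms by (auto simp: joint_distributionsD(3) space_PiM PiE_iff extensional_def override_on_def)

text \<open>After overwriting, the coordinates in \<open>K\<close> are constant, so the
  \<open>J\<close>-part of the result is a function of the coordinates in \<open>J - K\<close>
  alone. This is the freezing of coordinates on which the uniqueness argument rests.\<close>

lemma measurable_override_on:
  assumes p: "p \<in> joint_distributions E V" and K: "K \<subseteq> V" and J: "J \<subseteq> V" and s: "s \<in> space p"
  shows "(\<lambda>\<omega>. override_on \<omega> s K) \<in> measurable (coord_algebra E p (J - K)) (coord_algebra E p J)"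
  unfolding coord_algebra_def[of E p J]
proof (rule measurable_vimage_algebra2)
  show "(\<lambda>\<omega>. override_on \<omega> s K) \<in> space (coord_algebra E p (J - K)) \<rightarrow> space p"
    using override_on_in_space[OF p K s] by simp
  have JK: "J - K \<subseteq> V" using J by blast
  show "(\<lambda>\<omega>. restrict (override_on \<omega> s K) J) \<in> measurable (coord_algebra E p (J - K)) (PiM J E)"
  proof (rule measurable_restrict)
    fix i assume i: "i \<in> J"
    show "(\<lambda>\<omega>. override_on \<omega> s K i) \<in> measurable (coord_algebra E p (J - K)) (E i)"
    proof (cases "i \<in> K")
      case True
      have "s i \<in> space (E i)" using s i J by (auto simp: joint_distributionsD(3)[OF p] space_PiM)
      then show ?thesis using True by simp
    next
      case False
      then show ?thesis using measurable_component_coord_algebra[OF p JK, of i] i by simp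
    qed
  qed
qed

lemma measurable_override_on_joint:
  assumes p: "p \<in> joint_distributions E V" and K: "K \<subseteq> V" and s: "s \<in> space p"
  shows "(\<lambda>\<omega>. override_on \<omega> s K) \<in> measurable p (PiM V E)"
proof -
  have VK: "V - K \<subseteq> V" by blast
  have "(\<lambda>\<omega>. restrict \<omega> V) \<in> measurable (coord_algebra E p V) (PiM V E)"
    by (rule measurable_restrict_coord_algebra[OF p order_refl order_refl])
  from measurable_compose[OF measurable_override_on[OF p K order_refl s] this]
  have "(\<lambda>\<omega>. restrict (override_on \<omega> s K) V) \<in> measurable p (PiM V E)"
    by (rule measurable_from_subalg[OF subalgebra_coord_algebra[OF p VK]])
  \<comment> \<open>Points of the product space are extensional, so restricting them to
    \<open>V\<close> changes nothing.\<close>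
  moreover have "restrict (override_on \<omega> s K) V = override_on \<omega> s K" if "\<omega> \<in> space p" for \<omega>
    using override_on_in_space[OF p K s that]
    by (auto simp: joint_distributionsD(3)[OF p] space_PiM PiE_def extensional_restrict)
  ultimately show ?thesis by (subst measurable_cong[symmetric]) auto
qed

definition perturb ::
  "('i \<Rightarrow> 'a measure) \<Rightarrow> 'i set \<Rightarrow> 'i set \<Rightarrow> ('i \<Rightarrow> 'a) \<Rightarrow> real \<Rightarrow> ('i \<Rightarrow> 'a) measure \<Rightarrow> ('i \<Rightarrow> 'a) measure"
where
  "perturb E V K s e p = mixture e p (distr p (PiM V E) (\<lambda>\<omega>. override_on \<omega> s K))"

context
  fixes E :: "'i \<Rightarrow> 'a measure" and V K :: "'i set" and s :: "'i \<Rightarrow> 'a" and e :: real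
    and p :: "('i \<Rightarrow> 'a) measure"
  assumes p: "p \<in> joint_distributions E V" and K: "K \<subseteq> V" and s: "s \<in> space p"
    and e: "0 \<le> e" "e \<le> 1"
begin

lemma distr_override_on:
  "prob_space (distr p (PiM V E) (\<lambda>\<omega>. override_on \<omega> s K))"
  "sets (distr p (PiM V E) (\<lambda>\<omega>. override_on \<omega> s K)) = sets p"
  using prob_space.prob_space_distr[OF joint_distributionsD(1)[OF p] measurable_override_on_joint[OF p K s]]
    joint_distributionsD(2)[OF p] by auto

text \<open>The hypotheses shared by the mixture facts, in their order, for \<open>p\<close> and its
  overwritten image.\<close>

lemmas perturb_mixture = joint_distributionsD(1)[OF p] distr_override_on e

lemma perturb_in_joint_distributions: "perturb E V K s e p \<in> joint_distributions E V"
  using prob_space_mixture[OF perturb_mixture] sets_mixture[OF perturb_mixture]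
    joint_distributionsD(2)[OF p]
  by (simp add: perturb_def joint_distributions_def)

lemma tv_dist_perturb: "tv_dist E V p (perturb E V K s e p) \<le> e"
proof (rule tv_dist_least[OF p perturb_in_joint_distributions])
  fix A assume "A \<in> sets (PiM V E)"
  then have A: "A \<in> sets p" using joint_distributionsD(2)[OF p] by simp
  let ?r = "distr p (PiM V E) (\<lambda>\<omega>. override_on \<omega> s K)"
  have "measure p A - measure (perturb E V K s e p) A = e * (measure p A - measure ?r A)"
    unfolding perturb_def measure_mixture[OF perturb_mixture A] by (simp add: algebra_simps)
  moreover have "\<bar>measure p A - measure ?r A\<bar> \<le> 1"
    using prob_space.prob_le_1[OF joint_distributionsD(1)[OF p], of A]
      prob_space.prob_le_1[OF distr_override_on(1), of A] measure_nonneg[of p A] measure_nonneg[of ?r A]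
    by linarith
  ultimately show "\<bar>measure p A - measure (perturb E V K s e p) A\<bar> \<le> e"
    using e(1) mult_left_le[of "\<bar>measure p A - measure ?r A\<bar>" e] by (simp add: abs_mult)
qed

text \<open>A cylinder over coordinates outside \<open>K\<close> is its own preimage under the
  overwriting map, so both components of the mixture give it the same mass. This keeps the argument
  of \<open>c\<close> in C3 fixed along the approximation.\<close>

lemma marginal_perturb:
  assumes J: "J \<subseteq> V" "J \<inter> K = {}"
  shows "marginal E J (perturb E V K s e p) = marginal E J p"
proof (rule measure_eqI)
  let ?q = "perturb E V K s e p" and ?\<rho> = "\<lambda>\<omega>. restrict \<omega> J"
  let ?T = "\<lambda>\<omega>. override_on \<omega> s K"
  have m: "?\<rho> \<in> measurable r (PiM J E)" if "r \<in> joint_distributions E V" for r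
    using measurable_restrict_subset[OF J(1), of E] joint_distributionsD(2)[OF that]
    by (simp cong: measurable_cong_sets)
  show "sets (marginal E J ?q) = sets (marginal E J p)" by (simp add: marginal_def)
  fix A assume "A \<in> sets (marginal E J ?q)"
  then have A: "A \<in> sets (PiM J E)" by (simp add: marginal_def)
  have spq: "space ?q = space p"
    using joint_distributionsD(3)[OF p] joint_distributionsD(3)[OF perturb_in_joint_distributions]
    by simp
  let ?B = "?\<rho> -` A \<inter> space p"
  have B: "?B \<in> sets p" using measurable_sets[OF m[OF p] A] .
  have res: "restrict (?T \<omega>) J = restrict \<omega> J" for \<omega>
    using J(2) by (intro restrict_ext) (auto simp: override_on_def)
  have "emeasure (distr p (PiM V E) ?T) ?B = emeasure p (?T -` ?B \<inter> space p)"
    using B joint_distributionsD(2)[OF p]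
    by (intro emeasure_distr measurable_override_on_joint[OF p K s]) simp
  also have "?T -` ?B \<inter> space p = ?B"
    using res override_on_in_space[OF p K s] by auto
  finally have "emeasure ?q ?B = (ennreal e + ennreal (1 - e)) * emeasure p ?B"
    unfolding perturb_def emeasure_mixture[OF perturb_mixture B] by (simp only: distrib_right)
  also have "ennreal e + ennreal (1 - e) = 1"
    using e by (simp flip: ennreal_plus)
  finally have "emeasure ?q ?B = emeasure p ?B" by (simp only: mult_1_left)
  then show "emeasure (marginal E J ?q) A = emeasure (marginal E J p) A"
    unfolding marginal_def
    by (simp add: emeasure_distr[OF m[OF p] A] emeasure_distr[OF m[OF perturb_in_joint_distributions] A] spq)
qed

lemma
  fixes h :: "('i \<Rightarrow> 'a) \<Rightarrow> real"
  assumes h: "integrable p h" "integrable p (\<lambda>\<omega>. h (override_on \<omega> s K))"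
  shows integrable_perturb: "integrable (perturb E V K s e p) h"
    and integral_perturb: "(\<integral>\<omega>. h \<omega> \<partial>perturb E V K s e p)
      = e * (\<integral>\<omega>. h (override_on \<omega> s K) \<partial>p) + (1 - e) * (\<integral>\<omega>. h \<omega> \<partial>p)"
proof -
  let ?r = "distr p (PiM V E) (\<lambda>\<omega>. override_on \<omega> s K)"
  have hm: "h \<in> borel_measurable (PiM V E)"
    using borel_measurable_integrable[OF h(1)] joint_distributionsD(2)[OF p]
    by (simp cong: measurable_cong_sets)
  have hr: "integrable ?r h"
    using h(2) integrable_distr_eq[OF measurable_override_on_joint[OF p K s] hm] by simp
  show "integrable (perturb E V K s e p) h"
    unfolding perturb_def by (rule integrable_mixture[OF perturb_mixture h(1) hr])
  show "(\<integral>\<omega>. h \<omega> \<partial>perturb E V K s e p)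
      = e * (\<integral>\<omega>. h (override_on \<omega> s K) \<partial>p) + (1 - e) * (\<integral>\<omega>. h \<omega> \<partial>p)"
    unfolding perturb_def integral_mixture[OF perturb_mixture h(1) hr]
      integral_distr[OF measurable_override_on_joint[OF p K s] hm] by simp
qed

lemma AE_perturb:
  assumes P: "Measurable.pred p P" and "0 < e" and "AE \<omega> in perturb E V K s e p. P \<omega>"
  shows "AE \<omega> in p. P (override_on \<omega> s K)"
proof -
  let ?r = "distr p (PiM V E) (\<lambda>\<omega>. override_on \<omega> s K)"
  have "AE \<omega> in ?r. P \<omega>"
    using AE_mixture[OF perturb_mixture P assms(2)] assms(3) unfolding perturb_def by blast
  moreover have "{\<omega> \<in> space (PiM V E). P \<omega>} \<in> sets (PiM V E)"
    using P joint_distributionsD(2,3)[OF p] by (auto simp: pred_def)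
  ultimately show ?thesis
    using AE_distr_iff[OF measurable_override_on_joint[OF p K s], of P] by simp
qed

end

subsection \<open>Markov boundaries of the perturbed distribution\<close>

text \<open>One and the same function, a version of P(Y | M) under \<open>p\<close>, represents P(Y
  | S) under both \<open>p\<close> and \<open>q\<close>. The common function matters because
  \<open>q\<close> may charge \<open>p\<close>-null sets. It works because \<open>u\<close> and
  \<open>g\<close> are both invariant under overwriting \<open>S - M\<close>.\<close>

lemma cond_exp_perturb:
  fixes E :: "'i \<Rightarrow> 'a measure" and s :: "'i \<Rightarrow> 'a"
  assumes p: "p \<in> joint_distributions E (insert Y S)" and Y: "Y \<notin> S" and s: "s \<in> space p"
    and e: "0 \<le> e" "e \<le> 1" and M: "markov_blanket E p Y S M" and U: "U \<in> sets (PiM {Y} E)"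
  defines "q \<equiv> perturb E (insert Y S) (S - M) s e p"
    and "u \<equiv> \<lambda>x. indicator U (restrict x {Y}) :: real"
  shows "\<exists>g\<in>borel_measurable (coord_algebra E p M).
    (AE \<omega> in p. real_cond_exp p (coord_algebra E p S) u \<omega> = g \<omega>) \<and>
    (AE \<omega> in q. real_cond_exp q (coord_algebra E q S) u \<omega> = g \<omega>)"
proof -
  let ?V = "insert Y S" and ?K = "S - M" and ?T = "\<lambda>\<omega>. override_on \<omega> s (S - M)"
  let ?S = "coord_algebra E p S" and ?M = "coord_algebra E p M"
  have MS: "M \<subseteq> S" using M by (simp add: markov_blanket_def)
  have sub: "S \<subseteq> ?V" "M \<subseteq> ?V" "?K \<subseteq> ?V" using MS by auto
  note P = p sub(3) s e
  have q: "q \<in> joint_distributions E ?V"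
    unfolding q_def by (rule perturb_in_joint_distributions[OF P])
  have spq: "space q = space p"
    using joint_distributionsD(3)[OF p] joint_distributionsD(3)[OF q] by simp
  \<comment> \<open>\<open>coord_algebra\<close> depends on the measure only through its space, so
    \<open>p\<close> and \<open>q\<close> share these sigma-algebras.\<close>
  note cong = coord_algebra_cong[OF spq, of E]
  interpret FM: finite_measure_subalgebra p ?M by (rule finite_measure_subalgebra_coord_algebra[OF p sub(2)])
  interpret FS: finite_measure_subalgebra p ?S by (rule finite_measure_subalgebra_coord_algebra[OF p sub(1)])
  interpret QS: finite_measure_subalgebra q ?S
    using finite_measure_subalgebra_coord_algebra[OF q sub(1)] by (simp add: cong)
  define g where "g = real_cond_exp p ?M u"
  have gm: "g \<in> borel_measurable ?M" by (simp add: g_def)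
  have gae: "AE \<omega> in p. real_cond_exp p ?S u \<omega> = g \<omega>"
    using M U unfolding markov_blanket_iff[OF p MS] g_def u_def by blast
  have up: "integrable p u"
    unfolding u_def by (rule integrable_indicator_restrict[OF p _ U]) simp
  have uT: "u (?T \<omega>) = u \<omega>" for \<omega>
  proof -
    have "restrict (?T \<omega>) {Y} = restrict \<omega> {Y}"
      using Y by (intro restrict_ext) (auto simp: override_on_def)
    then show ?thesis by (simp only: u_def)
  qed
  have gp: "integrable p g" unfolding g_def by (rule FM.real_cond_exp_int(1)[OF up])
  have gT: "g (?T \<omega>) = g \<omega>" if "\<omega> \<in> space p" for \<omega>
  proof (rule coord_algebra_function_eq[OF p sub(2) gm])
    show "?T \<omega> \<in> space p" by (rule override_on_in_space[OF p sub(3) s that])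
    show "restrict (?T \<omega>) M = restrict \<omega> M"
      by (intro restrict_ext) (auto simp: override_on_def)
  qed (rule that)
  \<comment> \<open>For an invariant integrand, an integral under \<open>q\<close> reduces to
    integrals under \<open>p\<close>, over \<open>Z\<close> and over its preimage under
    \<open>?T\<close>.\<close>
  have setint: "(\<integral>\<omega>\<in>Z. h \<omega> \<partial>q)
      = e * (\<integral>\<omega>\<in>?T -` Z \<inter> space p. h \<omega> \<partial>p) + (1 - e) * (\<integral>\<omega>\<in>Z. h \<omega> \<partial>p)"
    if Z: "Z \<in> sets p" "?T -` Z \<inter> space p \<in> sets p" and h: "integrable p h"
      and hT: "\<And>\<omega>. \<omega> \<in> space p \<Longrightarrow> h (?T \<omega>) = h \<omega>" for Z and h :: "('i \<Rightarrow> 'a) \<Rightarrow> real"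
  proof -
    have 1: "indicator Z (?T \<omega>) *\<^sub>R h (?T \<omega>) = indicator (?T -` Z \<inter> space p) \<omega> *\<^sub>R h \<omega>"
      if "\<omega> \<in> space p" for \<omega>
      using that hT by (simp add: indicator_def)
    have 2: "integrable p (\<lambda>\<omega>. indicator Z (?T \<omega>) *\<^sub>R h (?T \<omega>))"
      by (rule iffD2[OF Bochner_Integration.integrable_cong[OF refl 1]
            integrable_mult_indicator[OF Z(2) h]])
    have 3: "(\<integral>\<omega>. indicator Z (?T \<omega>) *\<^sub>R h (?T \<omega>) \<partial>p) = (\<integral>\<omega>\<in>?T -` Z \<inter> space p. h \<omega> \<partial>p)"
      unfolding set_lebesgue_integral_def by (rule Bochner_Integration.integral_cong[OF refl 1])
    show ?thesis
      using integral_perturb[OF P integrable_mult_indicator[OF Z(1) h] 2]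
      unfolding 3 q_def[symmetric] unfolding set_lebesgue_integral_def .
  qed
  have "AE \<omega> in q. real_cond_exp q ?S u \<omega> = g \<omega>"
  proof (rule QS.real_cond_exp_charact)
    fix Z assume Z: "Z \<in> sets ?S"
    then have Zp: "Z \<in> sets p" using FS.subalg by (auto simp: subalgebra_def)
    \<comment> \<open>Overwriting leaves only the \<open>M\<close>-coordinates of an
      \<open>S\<close>-event free; hence the preimage is again an \<open>S\<close>-event, to which
      the identity \<open>eq\<close> under \<open>p\<close> applies.\<close>
    have TZ: "?T -` Z \<inter> space p \<in> sets ?M"
    proof -
      have "S - ?K = M" using MS by blast
      then show ?thesis
        using measurable_sets[OF measurable_override_on[OF p sub(3) sub(1) s] Z] by simp
    qed
    then have TZS: "?T -` Z \<inter> space p \<in> sets ?S"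
      using subalgebra_coord_algebra_mono[OF p MS sub(1)] by (auto simp: subalgebra_def)
    then have TZp: "?T -` Z \<inter> space p \<in> sets p" using FS.subalg by (auto simp: subalgebra_def)
    have eq: "(\<integral>\<omega>\<in>A. u \<omega> \<partial>p) = (\<integral>\<omega>\<in>A. g \<omega> \<partial>p)" if A: "A \<in> sets ?S" for A
    proof -
      have "A \<in> sets p" using A FS.subalg by (auto simp: subalgebra_def)
      then have "(\<integral>\<omega>\<in>A. real_cond_exp p ?S u \<omega> \<partial>p) = (\<integral>\<omega>\<in>A. g \<omega> \<partial>p)"
        using gp gae unfolding set_lebesgue_integral_def
        by (intro integral_cong_AE) (auto elim: eventually_mono)
      then show ?thesis using FS.real_cond_exp_intA[OF up A] by simp
    qed
    show "(\<integral>\<omega>\<in>Z. u \<omega> \<partial>q) = (\<integral>\<omega>\<in>Z. g \<omega> \<partial>q)"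
      using setint[of Z u, OF Zp TZp up uT] setint[of Z g, OF Zp TZp gp gT] eq[OF Z] eq[OF TZS]
      by presburger
  next
    show "integrable q u"
      unfolding q_def by (rule integrable_perturb[OF P up]) (simp only: uT up)
    have "integrable p (\<lambda>\<omega>. g (?T \<omega>))"
      by (rule iffD2[OF Bochner_Integration.integrable_cong[OF refl gT] gp])
    then show "integrable q g"
      unfolding q_def by (rule integrable_perturb[OF P gp])
    show "g \<in> borel_measurable ?S"
      by (rule measurable_from_subalg[OF subalgebra_coord_algebra_mono[OF p MS sub(1)] gm])
  qed
  with gm gae show ?thesis unfolding cong by (intro bexI[of _ g] conjI)
qed

lemma markov_blanket_perturb:
  assumes p: "p \<in> joint_distributions E (insert Y S)" and Y: "Y \<notin> S" and s: "s \<in> space p"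
    and e: "0 \<le> e" "e \<le> 1" and M: "markov_blanket E p Y S M"
  shows "markov_blanket E (perturb E (insert Y S) (S - M) s e p) Y S M"
proof -
  let ?q = "perturb E (insert Y S) (S - M) s e p"
  have q: "?q \<in> joint_distributions E (insert Y S)"
    by (rule perturb_in_joint_distributions[OF p _ s e]) auto
  have "space ?q = space p"
    using joint_distributionsD(3)[OF p] joint_distributionsD(3)[OF q] by simp
  then have cong: "coord_algebra E ?q M = coord_algebra E p M" by (rule coord_algebra_cong)
  show ?thesis
  proof (rule markov_blanketI[OF q])
    show "M \<subseteq> S" using M by (simp add: markov_blanket_def)
    fix U assume "U \<in> sets (PiM {Y} E)"
    then obtain g where "g \<in> borel_measurable (coord_algebra E p M)"
      and "AE \<omega> in ?q. real_cond_exp ?q (coord_algebra E ?q S)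
        (\<lambda>x. indicator U (restrict x {Y})) \<omega> = g \<omega>"
      using cond_exp_perturb[OF p Y s e M] by blast
    then show "\<exists>g\<in>borel_measurable (coord_algebra E ?q M). AE \<omega> in ?q.
        real_cond_exp ?q (coord_algebra E ?q S) (\<lambda>x. indicator U (restrict x {Y})) \<omega> = g \<omega>"
      unfolding cong by (intro bexI[of _ g])
  qed
qed

text \<open>Markov blankets need not be closed under intersection in general. Here two versions of
  P(Y | S) under \<open>?q\<close>, one seeing only \<open>M\<close> and one only \<open>M'\<close>,
  are compared after composition with \<open>?T\<close>.\<close>

lemma markov_blanket_Int_perturb:
  assumes p: "p \<in> joint_distributions E (insert Y S)" and Y: "Y \<notin> S" and s: "s \<in> space p"
    and e: "0 < e" "e \<le> 1" and M: "markov_blanket E p Y S M"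
    and M': "markov_blanket E (perturb E (insert Y S) (S - M) s e p) Y S M'"
  shows "markov_blanket E p Y S (M' \<inter> M)"
proof (rule markov_blanketI[OF p])
  let ?q = "perturb E (insert Y S) (S - M) s e p" and ?T = "\<lambda>\<omega>. override_on \<omega> s (S - M)"
  have MS: "M \<subseteq> S" "M' \<subseteq> S" using M M' by (simp_all add: markov_blanket_def)
  have sub: "S \<subseteq> insert Y S" "M \<subseteq> insert Y S" "M' \<subseteq> insert Y S" "S - M \<subseteq> insert Y S"
    using MS by auto
  note P = p sub(4) s less_imp_le[OF e(1)] e(2)
  have q: "?q \<in> joint_distributions E (insert Y S)"
    by (rule perturb_in_joint_distributions[OF P])
  have spq: "space ?q = space p"
    using joint_distributionsD(3)[OF p] joint_distributionsD(3)[OF q] by simp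
  note cong = coord_algebra_cong[OF spq, of E]
  show "M' \<inter> M \<subseteq> S" using MS by blast
  fix U assume U: "U \<in> sets (PiM {Y} E)"
  let ?u = "\<lambda>x. indicator U (restrict x {Y}) :: real"
  define g' where "g' = real_cond_exp ?q (coord_algebra E ?q M') ?u"
  obtain g where gm: "g \<in> borel_measurable (coord_algebra E p M)"
    and gp: "AE \<omega> in p. real_cond_exp p (coord_algebra E p S) ?u \<omega> = g \<omega>"
    and gq: "AE \<omega> in ?q. real_cond_exp ?q (coord_algebra E ?q S) ?u \<omega> = g \<omega>"
    using cond_exp_perturb[OF p Y s less_imp_le[OF e(1)] e(2) M U] by blast
  have g'm: "g' \<in> borel_measurable (coord_algebra E p M')"
    unfolding cong[of M', symmetric] g'_def by simp
  have "g \<in> borel_measurable p" "g' \<in> borel_measurable p"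
    using borel_measurable_coord_algebra_joint[OF p sub(2) gm] borel_measurable_coord_algebra_joint[OF p sub(3) g'm]
    by auto
  have "AE \<omega> in ?q. real_cond_exp ?q (coord_algebra E ?q S) ?u \<omega> = g' \<omega>"
    using M' U unfolding markov_blanket_iff[OF q MS(2)] g'_def by blast
  with gq have "AE \<omega> in ?q. g \<omega> = g' \<omega>" by eventually_elim simp
  \<comment> \<open>The overwritten image of \<open>p\<close> has positive weight in
    \<open>?q\<close>, so the equality holds almost surely under it and pulls back to
    \<open>p\<close>.\<close>
  then have "AE \<omega> in p. g (?T \<omega>) = g' (?T \<omega>)"
    by (rule AE_perturb[OF P _ e(1), rotated]) (unfold pred_def, rule borel_measurable_eq; fact)
  moreover have "AE \<omega> in p. g (?T \<omega>) = g \<omega>"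
  proof (rule AE_I2)
    fix \<omega> assume \<omega>: "\<omega> \<in> space p"
    show "g (?T \<omega>) = g \<omega>"
    proof (rule coord_algebra_function_eq[OF p sub(2) gm])
      show "?T \<omega> \<in> space p" by (rule override_on_in_space[OF p sub(4) s \<omega>])
      show "restrict (?T \<omega>) M = restrict \<omega> M"
        by (intro restrict_ext) (auto simp: override_on_def)
    qed (rule \<omega>)
  qed
  ultimately have "AE \<omega> in p. real_cond_exp p (coord_algebra E p S) ?u \<omega> = g' (?T \<omega>)"
    using gp by eventually_elim simp
  moreover have "(\<lambda>\<omega>. g' (?T \<omega>)) \<in> borel_measurable (coord_algebra E p (M' \<inter> M))"
  proof -
    \<comment> \<open>The coordinates of \<open>M'\<close> outside \<open>M\<close> are frozen at
      \<open>s\<close>, so \<open>g'\<close> composed with \<open>?T\<close> sees only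
      \<open>M' \<inter> M\<close>.\<close>
    have "M' - (S - M) = M' \<inter> M" using MS by blast
    then show ?thesis
      using measurable_compose[OF measurable_override_on[OF p sub(4) sub(3) s] g'm] by simp
  qed
  ultimately show "\<exists>g\<in>borel_measurable (coord_algebra E p (M' \<inter> M)).
      AE \<omega> in p. real_cond_exp p (coord_algebra E p S) ?u \<omega> = g \<omega>"
    by (rule bexI)
qed

lemma unique_markov_boundary_perturb:
  assumes p: "p \<in> joint_distributions E (insert Y S)" and Y: "Y \<notin> S" and s: "s \<in> space p"
    and e: "0 < e" "e \<le> 1" and M: "markov_boundary E p Y S M"
  shows "unique_markov_boundary E (perturb E (insert Y S) (S - M) s e p) Y S M"
proof -
  let ?q = "perturb E (insert Y S) (S - M) s e p"
  have Mb: "markov_blanket E p Y S M" using M by (simp add: markov_boundary_def)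
  have blanket: "markov_blanket E ?q Y S M"
    by (rule markov_blanket_perturb[OF p Y s less_imp_le[OF e(1)] e(2) Mb])
  \<comment> \<open>Being contained in every blanket makes \<open>M\<close> minimal, and any other
    boundary would have the blanket \<open>M\<close> as a proper subset.\<close>
  have "M \<subseteq> M'" if "markov_blanket E ?q Y S M'" for M'
  proof -
    have "\<not> M' \<inter> M \<subset> M"
      using markov_blanket_Int_perturb[OF p Y s e Mb that] M unfolding markov_boundary_def by blast
    then show ?thesis by blast
  qed
  with blanket show ?thesis
    unfolding unique_markov_boundary_def markov_boundary_def by blast
qed

section \<open>Distributions with a unique Markov boundary converging to \<open>p\<close>\<close>

lemma unique_markov_boundary_approximation:
  fixes E :: "'i \<Rightarrow> 'a measure" and S :: "'i set"
  assumes p: "p \<in> joint_distributions E (insert Y S)" and Y: "Y \<notin> S"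
    and M: "markov_boundary E p Y S M"
    and U: "openin (tv_topology E (insert Y S)) U" "p \<in> U" "U \<subseteq> N"
    and f: "criterion_C1 E Y S N f"
  obtains q where "\<And>n. q n \<in> N" "\<And>n. unique_markov_boundary E (q n) Y S M"
    "\<And>n. marginal E (insert Y M) (q n) = marginal E (insert Y M) p" "(\<lambda>n. f (q n)) \<longlonglongrightarrow> f p"
proof -
  let ?V = "insert Y S"
  interpret m: Metric_space "joint_distributions E ?V" "tv_dist E ?V"
    by (rule Metric_space_tv_dist)
  have "space p \<noteq> {}" by (rule prob_space.not_empty[OF joint_distributionsD(1)[OF p]])
  then obtain s where s: "s \<in> space p" by blast
  obtain r where r: "0 < r" "m.mball p r \<subseteq> U"
    using U(1,2) unfolding tv_topology_def m.openin_mtopology by blast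
  \<comment> \<open>The cap 1 makes \<open>e n\<close> a mixture weight, \<open>r / 2\<close> keeps
    it strictly below the radius of the ball, and \<open>Suc n\<close> keeps it positive from
    \<open>n = 0\<close> on.\<close>
  define e where "e n = min 1 (r / 2) / real (Suc n)" for n
  define q where "q n = perturb E ?V (S - M) s (e n) p" for n
  have e: "0 < e n" "e n \<le> 1" "e n < r" for n
  proof -
    have "e n \<le> min 1 (r / 2) / 1"
      unfolding e_def by (rule divide_left_mono) (use r(1) in auto)
    then show "e n \<le> 1" "e n < r" using r(1) by linarith+
    show "0 < e n" using r(1) by (simp add: e_def)
  qed
  have K: "S - M \<subseteq> ?V" by blast
  have P1: "q n \<in> joint_distributions E ?V" for n
    unfolding q_def by (rule perturb_in_joint_distributions[OF p K s less_imp_le[OF e(1)] e(2)])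
  have P2: "tv_dist E ?V p (q n) \<le> e n" for n
    unfolding q_def by (rule tv_dist_perturb[OF p K s less_imp_le[OF e(1)] e(2)])
  note P = P1 P2
  have qN: "q n \<in> N" for n
  proof -
    have "q n \<in> m.mball p r"
      unfolding m.in_mball using p P(1) order_le_less_trans[OF P(2) e(3)] by blast
    then show ?thesis using r(2) U(3) by blast
  qed
  have "e \<longlonglongrightarrow> 0"
    unfolding e_def by (rule LIMSEQ_Suc[OF lim_const_over_n])
  have "limitin (tv_topology E ?V) q p sequentially"
    unfolding tv_topology_def m.limitin_metric
  proof (intro conjI allI impI p)
    fix \<epsilon> :: real assume "0 < \<epsilon>"
    with \<open>e \<longlonglongrightarrow> 0\<close> have "eventually (\<lambda>n. e n < \<epsilon>) sequentially"
      by (rule order_tendstoD(2))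
    then show "\<forall>\<^sub>F n in sequentially. q n \<in> joint_distributions E ?V \<and> tv_dist E ?V (q n) p < \<epsilon>"
    proof eventually_elim
      case (elim n)
      have "tv_dist E ?V (q n) p \<le> e n" using P(2)[of n] by (simp only: m.commute)
      then show ?case using P(1) elim by (blast intro: order_le_less_trans)
    qed
  qed
  \<comment> \<open>C1 concerns the restriction of \<open>f\<close> to \<open>N\<close>, so
    convergence is needed in the subspace; all \<open>q n\<close> and \<open>p\<close> lie in
    \<open>N\<close>.\<close>
  then have "limitin (subtopology (tv_topology E ?V) N) q p sequentially"
    using qN U(2,3) by (auto simp: limitin_subtopology)
  then have "limitin euclideanreal (f \<circ> q) (f p) sequentially"
    using f unfolding criterion_C1_def by (rule continuous_map_limit[rotated])
  then have lim: "(\<lambda>n. f (q n)) \<longlonglongrightarrow> f p" by (simp add: o_def)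
  have MS: "M \<subseteq> S" using M by (simp add: markov_boundary_def markov_blanket_def)
  show thesis
  proof (rule that[OF qN _ _ lim])
    show "unique_markov_boundary E (q n) Y S M" for n
      unfolding q_def by (rule unique_markov_boundary_perturb[OF p Y s e(1,2) M])
    show "marginal E (insert Y M) (q n) = marginal E (insert Y M) p" for n
      unfolding q_def
      by (rule marginal_perturb[OF p K s less_imp_le[OF e(1)] e(2)]) (use MS Y in auto)
  qed
qed

theorem theorem1:
  fixes E :: "'i \<Rightarrow> 'a measure"
    and X Y :: 'i and S :: "'i set"
    and p :: "('i \<Rightarrow> 'a) measure"
    and N U :: "('i \<Rightarrow> 'a) measure set"
    and f :: "('i \<Rightarrow> 'a) measure \<Rightarrow> real"
    and c :: "'i \<Rightarrow> 'i \<Rightarrow> 'i set \<Rightarrow> ('i \<Rightarrow> 'a) measure \<Rightarrow> real"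
  assumes "finite S" and "Y \<notin> S" and "X \<in> S"
    and "p \<in> joint_distributions E (insert Y S)"
    and "\<exists>M1 M2. M1 \<noteq> M2 \<and> markov_boundary E p Y S M1 \<and> markov_boundary E p Y S M2"
    and "\<exists>M. markov_boundary E p Y S M \<and> X \<in> M"
    and "\<exists>M. markov_boundary E p Y S M \<and> X \<notin> M"
    and "N \<subseteq> joint_distributions E (insert Y S)"
    and "openin (tv_topology E (insert Y S)) U" and "p \<in> U" and "U \<subseteq> N"
  shows "\<not> criterion_C1 E Y S N f \<or> \<not> criterion_C2 E X Y S N f \<or> \<not> criterion_C3 E c X Y S N f"
proof (rule ccontr)
  assume "\<not> ?thesis"
  then have C1: "criterion_C1 E Y S N f" and C2: "criterion_C2 E X Y S N f"
    and C3: "criterion_C3 E c X Y S N f" by blast+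
  \<comment> \<open>Used twice, once with a boundary avoiding \<open>X\<close> and once with a
    boundary containing it, giving contradictory values of \<open>f p\<close>.\<close>
  note limit = unique_markov_boundary_approximation[OF assms(4,2) _ assms(9-11) C1]
  have "f p = 0"
  proof -
    obtain M where M: "markov_boundary E p Y S M" "X \<notin> M" using assms(7) by blast
    obtain q where q: "\<And>n. q n \<in> N" "\<And>n. unique_markov_boundary E (q n) Y S M"
      "\<And>n. marginal E (insert Y M) (q n) = marginal E (insert Y M) p"
      "(\<lambda>n. f (q n)) \<longlonglongrightarrow> f p" by (rule limit[OF M(1)]) (rule that)
    have "f (q n) = 0" for n
      using C2 q(1)[of n] q(2)[of n] M(2) unfolding criterion_C2_def by blast
    then show ?thesis using q(4) by (simp add: LIMSEQ_const_iff)
  qed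
  moreover have "f p \<noteq> 0"
  proof -
    obtain M where M: "markov_boundary E p Y S M" "X \<in> M" using assms(6) by blast
    obtain q where q: "\<And>n. q n \<in> N" "\<And>n. unique_markov_boundary E (q n) Y S M"
      "\<And>n. marginal E (insert Y M) (q n) = marginal E (insert Y M) p"
      "(\<lambda>n. f (q n)) \<longlonglongrightarrow> f p" by (rule limit[OF M(1)]) (rule that)
    let ?c = "c X Y (M - {X}) (marginal E (insert Y M) p)"
    \<comment> \<open>The variables visible to \<open>c\<close> are exactly \<open>Y\<close> and
      those in \<open>M\<close>, whose joint law is the same under every \<open>q n\<close> as under
      \<open>p\<close>; so \<open>?c\<close> does not vary with \<open>n\<close>.\<close>
    have XM: "{X, Y} \<union> (M - {X}) = insert Y M" using M(2) by blast
    \<comment> \<open>Positivity comes from C3 at \<open>q n\<close>, where \<open>M\<close> is the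
      unique boundary; C3 says nothing at \<open>p\<close> itself, which has several.\<close>
    have c: "0 < ?c" "?c \<le> \<bar>f (q n)\<bar>" for n
    proof -
      have "0 < c X Y (M - {X}) (marginal E ({X, Y} \<union> (M - {X})) (q n)) \<and>
          c X Y (M - {X}) (marginal E ({X, Y} \<union> (M - {X})) (q n)) \<le> \<bar>f (q n)\<bar>"
        using C3 q(1)[of n] q(2)[of n] M(2) unfolding criterion_C3_def by blast
      then show "0 < ?c" "?c \<le> \<bar>f (q n)\<bar>" by (simp_all only: XM q(3))
    qed
    have "?c \<le> \<bar>f p\<bar>"
      by (rule LIMSEQ_le_const[OF tendsto_rabs[OF q(4)]]) (use c(2) in blast)
    then show ?thesis using c(1) by linarith
  qed
  ultimately show False by contradiction
qed

end
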